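(* Let $N\ge 1$ be an integer and $0<\epsilon<1$. For each $t\ge1$ let $K_t^*$ be the optimal block size (a maximizer in the Bellman equation given in the context) and let $\hat K_t=\arg\max_{K\in\{0,1,\dots,t\}}R_t(K)$ be the greedy block size. Then $K_t^*\le \hat K_t$ for every $t\ge 1$.
   Context: A transmitter broadcasts packets to $N$ receivers over i.i.d. binary erasure channels with erasure probability $\epsilon$, one coded packet per slot. A block of $K$ packets coded together is decoded by a receiver once it has received $K$ packets successfully. For integers $K\ge 1$, $T\ge 0$, the probability that all $N$ receivers decode a block of size $K$ within $T$ slots is $$P(K,T)=\left(\sum_{\tau=K}^{T}\binom{\tau-1}{K-1}\epsilon^{\tau-K}(1-\epsilon)^K\right)^N,$$ with $P(K,T)=0$ if $T<K$. The state $t$ is the number of slots remaining before the deadline, and the action is the block size. It is assumed that there are always more than $t$ undelivered packets at state $t$, so at state $t\ge1$ the block size $K$ is chosen from $\{1,\dots,t\}$; at state $0$ nothing is transmitted. The expected immediate reward is $R_t(K)=K\,P(K,t)$, with $R_t(0)=0$. For a block of size $K$ started at state $t$, let $q_t(j)=P(K,t-j)-P(K,t-j-1)$ be the probability that the block is delivered to all receivers when exactly $j$ slots remain ($0\le j\le t-K$). The optimal value $V_t$ is defined by $V_0=0$ and the Bellman equation $$V_t=\max_{K\in\{1,\dots,t\}}\Big\{R_t(K)+\sum_{j=0}^{t-K}q_t(j)\,V_j\Big\},\qquad t\ge1,$$ and $K_t^*$ is a value of $K$ attaining this maximum. The greedy block size $\hat K_t$ maximizes only the immediate reward $R_t$.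 *)

theory Defs
  imports Complex_Main
begin

definition block_prob :: "nat \<Rightarrow> real \<Rightarrow> nat \<Rightarrow> nat \<Rightarrow> real" where
  "block_prob N \<epsilon> K T =
    (if T < K then 0
     else (\<Sum>\<tau>=K..T. real ((\<tau> - 1) choose (K - 1)) * \<epsilon> ^ (\<tau> - K) * (1 - \<epsilon>) ^ K) ^ N)"

definition reward :: "nat \<Rightarrow> real \<Rightarrow> nat \<Rightarrow> nat \<Rightarrow> real" where
  "reward N \<epsilon> t K = real K * block_prob N \<epsilon> K t"

text \<open>\<open>block_prob\<close> is meaningful for \<open>K \<ge> 1\<close> only; its value at \<open>K = 0\<close> never
  matters, since it occurs there only as a factor of the reward.\<close>

lemma reward_0: "reward N \<epsilon> t 0 = 0"
  by (simp add: reward_def)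

text \<open>The truncated subtraction is harmless: this is only used for \<open>j \<le> t - K\<close>
  and \<open>1 \<le> K \<le> t\<close>, so that \<open>j + 1 \<le> t\<close>.\<close>

definition delivery_prob :: "nat \<Rightarrow> real \<Rightarrow> nat \<Rightarrow> nat \<Rightarrow> nat \<Rightarrow> real" where
  "delivery_prob N \<epsilon> t K j = block_prob N \<epsilon> K (t - j) - block_prob N \<epsilon> K (t - j - 1)"

definition bellman_objective ::
    "nat \<Rightarrow> real \<Rightarrow> (nat \<Rightarrow> real) \<Rightarrow> nat \<Rightarrow> nat \<Rightarrow> real" where
  "bellman_objective N \<epsilon> v t K =
    reward N \<epsilon> t K + (\<Sum>j=0..t - K. delivery_prob N \<epsilon> t K j * v j)"

text \<open>The Bellman objective at \<open>t\<close> with a block size \<open>K \<ge> 1\<close> only looks at values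
  \<open>v j\<close> with \<open>j < t\<close>; the congruence rule exposes this to the termination proof.\<close>

lemma bellman_objective_cong [fundef_cong]:
  assumes "N = N'" "\<epsilon> = \<epsilon>'" "t = t'" "K = K'"
    and "\<And>j. j \<le> t' - K' \<Longrightarrow> v j = v' j"
  shows "bellman_objective N \<epsilon> v t K = bellman_objective N' \<epsilon>' v' t' K'"
  using assms by (simp add: bellman_objective_def)

function opt_value :: "nat \<Rightarrow> real \<Rightarrow> nat \<Rightarrow> real" where
  "opt_value N \<epsilon> t =
    (if t = 0 then 0
     else Max ((\<lambda>K. bellman_objective N \<epsilon> (\<lambda>j. opt_value N \<epsilon> j) t K) ` {1..t}))"
  by pat_completeness auto
termination
  by (relation "measure (\<lambda>(N, \<epsilon>, t). t)") auto

declare opt_value.simps [simp del]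

lemma opt_value_0: "opt_value N \<epsilon> 0 = 0"
  by (simp add: opt_value.simps)

lemma opt_value_bellman:
  assumes "t \<ge> 1"
  shows "opt_value N \<epsilon> t =
    Max ((\<lambda>K. reward N \<epsilon> t K
            + (\<Sum>j=0..t - K. delivery_prob N \<epsilon> t K j * opt_value N \<epsilon> j)) ` {1..t})"
  using assms by (subst opt_value.simps) (simp add: bellman_objective_def)

text \<open>Both predicates describe an arbitrary maximizer; no tie-breaking rule is imposed.\<close>

definition optimal_block_size :: "nat \<Rightarrow> real \<Rightarrow> nat \<Rightarrow> nat \<Rightarrow> bool" where
  "optimal_block_size N \<epsilon> t K \<longleftrightarrow>
    is_arg_max (bellman_objective N \<epsilon> (opt_value N \<epsilon>) t) (\<lambda>k. k \<in> {1..t}) K"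

definition greedy_block_size :: "nat \<Rightarrow> real \<Rightarrow> nat \<Rightarrow> nat \<Rightarrow> bool" where
  "greedy_block_size N \<epsilon> t K \<longleftrightarrow>
    is_arg_max (reward N \<epsilon> t) (\<lambda>k. k \<in> {0..t}) K"

end

theory Submission imports Defs begin

text \<open>Since \<open>V\<^sub>0 = 0\<close>, summation by parts turns the continuation value of block size \<open>K\<close> into
  \<open>\<Sum>j<t. P(K, t - 1 - j) (V\<^sub>j\<^sub>+\<^sub>1 - V\<^sub>j)\<close>. As \<open>P(K, T)\<close> is increasing in \<open>T\<close>, induction shows that
  \<open>V\<close> is increasing; as \<open>P(K, T)\<close> is decreasing in \<open>K\<close>, the continuation value is then decreasing
  in \<open>K\<close>, strictly so because of the summand \<open>j = 0\<close>. A block larger than the greedy one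
  therefore earns no more immediately and strictly less afterwards.\<close>

definition nbinom_cdf :: "real \<Rightarrow> nat \<Rightarrow> nat \<Rightarrow> real" where
  "nbinom_cdf \<epsilon> K T =
    (\<Sum>\<tau>=K..T. real ((\<tau> - 1) choose (K - 1)) * \<epsilon> ^ (\<tau> - K) * (1 - \<epsilon>) ^ K)"

text \<open>For \<open>T < K\<close> the sum is empty and \<open>0 ^ N = 0\<close> as
  \<open>N \<ge> 1\<close>, so the case distinction in \<open>block_prob\<close> disappears.\<close>

lemma block_prob_eq_cdf_power:
  assumes "N \<ge> 1"
  shows "block_prob N \<epsilon> K T = nbinom_cdf \<epsilon> K T ^ N"
  using assms by (simp add: block_prob_def nbinom_cdf_def)

lemma nbinom_cdf_eq_0: "T < K \<Longrightarrow> nbinom_cdf \<epsilon> K T = 0"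
  by (simp add: nbinom_cdf_def)

lemma nbinom_cdf_Suc:
  assumes "K \<le> Suc T"
  shows "nbinom_cdf \<epsilon> K (Suc T) = nbinom_cdf \<epsilon> K T
    + real (T choose (K - 1)) * \<epsilon> ^ (Suc T - K) * (1 - \<epsilon>) ^ K"
  using assms by (simp add: nbinom_cdf_def)

text \<open>The difference is the probability of exactly \<open>K\<close> successes in \<open>T\<close> slots.\<close>

lemma nbinom_cdf_diff:
  assumes "1 \<le> K" "K \<le> T"
  shows "nbinom_cdf \<epsilon> K T - nbinom_cdf \<epsilon> (Suc K) T =
    real (T choose K) * \<epsilon> ^ (T - K) * (1 - \<epsilon>) ^ K"
  using assms(2)
proof (induction T rule: dec_induct)
  case base
  show ?case by (simp add: nbinom_cdf_def)
next
  case (step T)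
  obtain k where K: "K = Suc k" using assms(1) by (cases K) auto
  obtain d where T: "T = K + d" using step.hyps(1) le_Suc_ex by blast
  \<comment> \<open>Slot \<open>Suc T\<close> adds one summand to each sum; the first term comes
    from the induction hypothesis.\<close>
  have "nbinom_cdf \<epsilon> K (Suc T) - nbinom_cdf \<epsilon> (Suc K) (Suc T) =
      real (T choose K) * \<epsilon> ^ d * (1 - \<epsilon>) ^ K
      + real (T choose k) * \<epsilon> ^ Suc d * (1 - \<epsilon>) ^ K
      - real (T choose K) * \<epsilon> ^ d * (1 - \<epsilon>) ^ Suc K"
    using step.IH step.hyps(1) by (simp add: nbinom_cdf_Suc K T Suc_diff_le)
  \<comment> \<open>The outer terms combine through
    \<open>1 - (1 - \<epsilon>) = \<epsilon>\<close>; Pascal's rule then finishes.\<close>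
  also have "\<dots> = (real (T choose k) + real (T choose K)) * \<epsilon> ^ Suc d * (1 - \<epsilon>) ^ K"
    by (simp add: algebra_simps)
  also have "\<dots> = real (Suc T choose K) * \<epsilon> ^ (Suc T - K) * (1 - \<epsilon>) ^ K"
    by (simp add: K T Suc_diff_le)
  finally show ?case .
qed

context
  fixes N :: nat and \<epsilon> :: real
  assumes N: "N \<ge> 1" and eps0: "0 < \<epsilon>" and eps1: "\<epsilon> < 1"
begin

lemma nbinom_cdf_nonneg: "0 \<le> nbinom_cdf \<epsilon> K T"
  unfolding nbinom_cdf_def using eps0 eps1 by (intro sum_nonneg) simp

lemma nbinom_cdf_mono: "T \<le> T' \<Longrightarrow> nbinom_cdf \<epsilon> K T \<le> nbinom_cdf \<epsilon> K T'"
  unfolding nbinom_cdf_def using eps0 eps1 by (intro sum_mono2) auto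

lemma nbinom_cdf_Suc_less:
  assumes "1 \<le> K" "K \<le> T"
  shows "nbinom_cdf \<epsilon> (Suc K) T < nbinom_cdf \<epsilon> K T"
proof -
  have "0 < real (T choose K) * \<epsilon> ^ (T - K) * (1 - \<epsilon>) ^ K"
    using assms eps0 eps1 by simp
  then show ?thesis using nbinom_cdf_diff[OF assms, of \<epsilon>] by linarith
qed

lemma nbinom_cdf_antimono:
  assumes "1 \<le> K" "K \<le> L"
  shows "nbinom_cdf \<epsilon> L T \<le> nbinom_cdf \<epsilon> K T"
  using assms(2)
proof (induction L rule: dec_induct)
  case (step L)
  have "nbinom_cdf \<epsilon> (Suc L) T \<le> nbinom_cdf \<epsilon> L T"
  proof (cases "L \<le> T")
    case True
    then show ?thesis using nbinom_cdf_Suc_less[of L T] assms(1) step.hyps(1) by simp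
  qed (simp add: nbinom_cdf_eq_0)
  then show ?case using step.IH by simp
qed simp

lemma nbinom_cdf_strict_antimono:
  assumes "1 \<le> K" "K < L" "K \<le> T"
  shows "nbinom_cdf \<epsilon> L T < nbinom_cdf \<epsilon> K T"
  using nbinom_cdf_antimono[of "Suc K" L T] nbinom_cdf_Suc_less[of K T] assms by simp

lemma block_prob_mono: "T \<le> T' \<Longrightarrow> block_prob N \<epsilon> K T \<le> block_prob N \<epsilon> K T'"
  by (simp add: block_prob_eq_cdf_power[OF N] power_mono nbinom_cdf_mono nbinom_cdf_nonneg)

lemma block_prob_antimono:
  "1 \<le> K \<Longrightarrow> K \<le> L \<Longrightarrow> block_prob N \<epsilon> L T \<le> block_prob N \<epsilon> K T"
  by (simp add: block_prob_eq_cdf_power[OF N] power_mono nbinom_cdf_antimono nbinom_cdf_nonneg)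

lemma block_prob_strict_antimono:
  "1 \<le> K \<Longrightarrow> K < L \<Longrightarrow> K \<le> T \<Longrightarrow> block_prob N \<epsilon> L T < block_prob N \<epsilon> K T"
  using N nbinom_cdf_strict_antimono[of K L T] nbinom_cdf_nonneg[of L T]
  by (simp add: block_prob_eq_cdf_power[OF N] power_strict_mono)

text \<open>Compare with size \<open>Suc T\<close>, which cannot be delivered within
  \<open>T\<close> slots.\<close>

lemma block_prob_pos: "1 \<le> K \<Longrightarrow> K \<le> T \<Longrightarrow> 0 < block_prob N \<epsilon> K T"
  using block_prob_strict_antimono[of K "Suc T" T] by (simp add: block_prob_def)

lemma bellman_objective_by_parts:
  assumes "v 0 = 0" "1 \<le> K" "K \<le> t"
  shows "bellman_objective N \<epsilon> v t K = reward N \<epsilon> t K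
    + (\<Sum>j<t. block_prob N \<epsilon> K (t - Suc j) * (v (Suc j) - v j))"
proof -
  let ?a = "\<lambda>j. block_prob N \<epsilon> K (t - j)"
  \<comment> \<open>For \<open>t - K < j < t\<close> fewer than \<open>K\<close> slots have elapsed,
    so both block probabilities vanish and the sum may run to \<open>t\<close>.\<close>
  have "(\<Sum>j=0..t - K. delivery_prob N \<epsilon> t K j * v j) = (\<Sum>j<t. (?a j - ?a (Suc j)) * v j)"
    using assms by (intro sum.mono_neutral_cong_left) (auto simp: delivery_prob_def block_prob_def)
  moreover have "(\<Sum>j<t. (?a j - ?a (Suc j)) * v j) - (\<Sum>j<t. ?a (Suc j) * (v (Suc j) - v j))
      = (\<Sum>j<t. ?a j * v j - ?a (Suc j) * v (Suc j))"
    by (simp add: sum_subtractf[symmetric] algebra_simps)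
  moreover have "\<dots> = ?a 0 * v 0 - ?a t * v t"
    by (rule sum_lessThan_telescope')
  \<comment> \<open>Both boundary terms vanish: \<open>v 0 = 0\<close>, and no block of size
    \<open>K \<ge> 1\<close> is delivered in \<open>0\<close> slots.\<close>
  moreover have "\<dots> = 0"
    using assms by (simp add: block_prob_def)
  ultimately show ?thesis
    by (simp add: bellman_objective_def)
qed

lemma opt_value_ge:
  assumes "1 \<le> K" "K \<le> t"
  shows "bellman_objective N \<epsilon> (opt_value N \<epsilon>) t K \<le> opt_value N \<epsilon> t"
  using assms by (auto simp: opt_value.simps[of N \<epsilon> t])

lemma opt_value_attained:
  assumes "1 \<le> t"
  obtains K where "1 \<le> K" "K \<le> t"
    "opt_value N \<epsilon> t = bellman_objective N \<epsilon> (opt_value N \<epsilon>) t K"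
proof -
  let ?S = "(\<lambda>K. bellman_objective N \<epsilon> (opt_value N \<epsilon>) t K) ` {1..t}"
  have "opt_value N \<epsilon> t = Max ?S"
    using assms by (simp add: opt_value.simps[of N \<epsilon> t])
  moreover have "Max ?S \<in> ?S"
    using assms by (intro Max_in) auto
  ultimately show ?thesis using that by auto
qed

text \<open>This first increment of the value function is the source of all later
  strictness.\<close>

lemma opt_value_1_pos: "0 < opt_value N \<epsilon> 1"
proof -
  have "0 < bellman_objective N \<epsilon> (opt_value N \<epsilon>) 1 1"
    using block_prob_pos[of 1 1]
    by (simp add: bellman_objective_def reward_def opt_value_0)
  then show ?thesis using opt_value_ge[of 1 1] by simp
qed

text \<open>A block size optimal at \<open>t\<close> remains admissible at \<open>Suc t\<close>,
  where the extra slot can only help.\<close>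

lemma opt_value_Suc_ge: "opt_value N \<epsilon> t \<le> opt_value N \<epsilon> (Suc t)"
proof (induction t rule: less_induct)
  case (less t)
  let ?V = "opt_value N \<epsilon>" and ?P = "block_prob N \<epsilon>"
  show ?case
  proof (cases "t = 0")
    case True
    then show ?thesis using opt_value_1_pos by (simp add: opt_value_0)
  next
    case False
    then obtain K where K: "1 \<le> K" "K \<le> t" "?V t = bellman_objective N \<epsilon> ?V t K"
      by (auto intro: opt_value_attained[of t])
    \<comment> \<open>The induction hypothesis makes every increment with \<open>j < t\<close>
      nonnegative.\<close>
    have "(\<Sum>j<t. ?P K (t - Suc j) * (?V (Suc j) - ?V j))
        \<le> (\<Sum>j<t. ?P K (Suc t - Suc j) * (?V (Suc j) - ?V j))"
      using less.IH by (intro sum_mono mult_right_mono block_prob_mono) auto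
    \<comment> \<open>At \<open>Suc t\<close> the sum has an extra summand \<open>j = t\<close>,
      whose increment has the very sign to be proved; its coefficient is zero, which avoids
      circularity.\<close>
    moreover have "?P K (Suc t - Suc t) = 0"
      using K by (simp add: block_prob_def)
    moreover have "reward N \<epsilon> t K \<le> reward N \<epsilon> (Suc t) K"
      by (simp add: reward_def mult_left_mono block_prob_mono)
    ultimately have "bellman_objective N \<epsilon> ?V t K \<le> bellman_objective N \<epsilon> ?V (Suc t) K"
      using K by (simp add: bellman_objective_by_parts opt_value_0)
    also have "\<dots> \<le> ?V (Suc t)"
      using K by (intro opt_value_ge) auto
    finally show ?thesis using K by simp
  qed
qed

lemma continuation_strict_antimono:
  assumes "1 \<le> K" "K < L" "L \<le> t"
  shows "(\<Sum>j<t. block_prob N \<epsilon> L (t - Suc j) * (opt_value N \<epsilon> (Suc j) - opt_value N \<epsilon> j))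
    < (\<Sum>j<t. block_prob N \<epsilon> K (t - Suc j) * (opt_value N \<epsilon> (Suc j) - opt_value N \<epsilon> j))"
proof (rule sum_strict_mono_ex1)
  show "\<forall>j\<in>{..<t}. block_prob N \<epsilon> L (t - Suc j) * (opt_value N \<epsilon> (Suc j) - opt_value N \<epsilon> j)
      \<le> block_prob N \<epsilon> K (t - Suc j) * (opt_value N \<epsilon> (Suc j) - opt_value N \<epsilon> j)"
    using assms by (auto intro!: mult_right_mono block_prob_antimono simp: opt_value_Suc_ge)
  \<comment> \<open>This is the summand \<open>j = 0\<close>; strictness applies because
    \<open>K < L \<le> t\<close> gives \<open>K \<le> t - 1\<close>.\<close>
  have "block_prob N \<epsilon> L (t - 1) * opt_value N \<epsilon> 1 < block_prob N \<epsilon> K (t - 1) * opt_value N \<epsilon> 1"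
    using assms opt_value_1_pos by (intro mult_strict_right_mono block_prob_strict_antimono) auto
  then show "\<exists>j\<in>{..<t}. block_prob N \<epsilon> L (t - Suc j) * (opt_value N \<epsilon> (Suc j) - opt_value N \<epsilon> j)
      < block_prob N \<epsilon> K (t - Suc j) * (opt_value N \<epsilon> (Suc j) - opt_value N \<epsilon> j)"
    using assms by (intro bexI[of _ 0]) (auto simp: opt_value_0)
qed simp

end

theorem theorem2:
  fixes N :: nat and \<epsilon> :: real and t Kstar Khat :: nat
  assumes "N \<ge> 1" and "0 < \<epsilon>" and "\<epsilon> < 1"
    and "t \<ge> 1"
    and "optimal_block_size N \<epsilon> t Kstar"
    and "greedy_block_size N \<epsilon> t Khat"
  shows "Kstar \<le> Khat"
proof (rule ccontr)
  assume "\<not> Kstar \<le> Khat"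
  then have less: "Khat < Kstar" by simp
  have star: "1 \<le> Kstar" "Kstar \<le> t"
    and opt: "\<And>K. 1 \<le> K \<Longrightarrow> K \<le> t \<Longrightarrow>
      bellman_objective N \<epsilon> (opt_value N \<epsilon>) t K \<le> bellman_objective N \<epsilon> (opt_value N \<epsilon>) t Kstar"
    using assms(5) by (auto simp: optimal_block_size_def is_arg_max_linorder)
  have greedy: "\<And>K. K \<le> t \<Longrightarrow> reward N \<epsilon> t K \<le> reward N \<epsilon> t Khat"
    using assms(6) by (auto simp: greedy_block_size_def is_arg_max_linorder)
  \<comment> \<open>The greedy choice ranges over \<open>0\<close> too, but the comparison of
    continuation values needs a size of at least \<open>1\<close>.\<close>
  have "0 < reward N \<epsilon> t 1"
    using block_prob_pos[OF assms(1-3), of 1 t] assms(4) by (simp add: reward_def)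
  with greedy[of 1] assms(4) have "1 \<le> Khat"
    by (cases "Khat = 0") (auto simp: reward_0)
  with less star have "bellman_objective N \<epsilon> (opt_value N \<epsilon>) t Kstar
      < bellman_objective N \<epsilon> (opt_value N \<epsilon>) t Khat"
    using continuation_strict_antimono[OF assms(1-3), of Khat Kstar t] greedy[of Kstar]
    by (simp add: bellman_objective_by_parts[OF assms(1-3)] opt_value_0)
  with opt[of Khat] \<open>1 \<le> Khat\<close> less star show False by simp
qed

end
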